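(* For $r \in \{1,\infty\}$ and $N \in \{0,2\}$, the metric space $\mathbb{G}_r(N)$ (with metric $(x,y)\mapsto p(x-y)$, $p$ its value) is Urysohn.
   Context: All groups are Abelian. A value on $G$ is $p\colon G\to[0,\infty)$ with $p(x)=0\iff x=0$, $p(-x)=p(x)$, $p(x+y)\leqslant p(x)+p(y)$. Class $\mathcal{O}_0$: $\lim_n p(na)/n=0$ for all $a$. $\mathfrak{G}_r(N)$: separable valued Abelian groups of class $\mathcal{O}_0$ with $p\leqslant r$ (vacuous if $r=\infty$) and of exponent $N$ if $N\neq0$. $\mathbb{G}_r(N)$ is the valued Abelian group, unique up to isometric group isomorphism, which (G1) is complete and in $\mathfrak{G}_r(N)$; (G2) for every finite valued Abelian group $(H,+,q)$ (of exponent $N$ if $N\neq0$) with $q\leqslant r$, subgroup $K$, isometric homomorphism $\varphi\colon K\to\mathbb{G}_r(N)$ and $\varepsilon\in(0,1)$, there is a homomorphism $\varphi_\varepsilon\colon H\to\mathbb{G}_r(N)$ with $p(\varphi(x)-\varphi_\varepsilon(x))\leqslant\varepsilon$ on $K$ and $(1-\varepsilon)q\leqslant p\circ\varphi_\varepsilon\leqslant(1+\varepsilon)q$ on $H$; (G3) if $N=0$, finite-order elements are dense. A metric space $X$ is Urysohn if (U0) it is separable and complete, (U1) every separable metric space of diameter no greater than the diameter of $X$ isometrically embeds into $X$, and (U2) every isometry between two finite subsets of $X$ extends to an isometry of $X$ onto $X$. *)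

theory Defs
  imports "HOL-Analysis.Analysis" "HOL-Algebra.Group"
begin

definition metric_diam :: "'a set \<Rightarrow> ('a \<Rightarrow> 'a \<Rightarrow> real) \<Rightarrow> ereal" where
  "metric_diam X d = (SUP x\<in>X. SUP y\<in>X. ereal (d x y))"

text \<open>Urysohn space (U0),(U1),(U2).  The type argument fixes the ambient type of the
  separable metric spaces quantified over in (U1); a theorem whose conclusion is
  Urysohn TYPE('b) ... with 'b free holds for metric spaces carried by any type.\<close>
definition Urysohn :: "'b itself \<Rightarrow> 'a set \<Rightarrow> ('a \<Rightarrow> 'a \<Rightarrow> real) \<Rightarrow> bool" where
  "Urysohn T X d \<longleftrightarrow>
     Metric_space X d \<and>
     separable_space (Metric_space.mtopology X d) \<and> Metric_space.mcomplete X d \<and>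
     (\<forall>(S::'b set) e. Metric_space S e \<and> separable_space (Metric_space.mtopology S e) \<and>
         metric_diam S e \<le> metric_diam X d \<longrightarrow>
         (\<exists>f. f ` S \<subseteq> X \<and> (\<forall>x\<in>S. \<forall>y\<in>S. d (f x) (f y) = e x y))) \<and>
     (\<forall>A B f. A \<subseteq> X \<and> B \<subseteq> X \<and> finite A \<and> finite B \<and> bij_betw f A B \<and>
         (\<forall>x\<in>A. \<forall>y\<in>A. d (f x) (f y) = d x y) \<longrightarrow>
         (\<exists>g. bij_betw g X X \<and> (\<forall>x\<in>X. \<forall>y\<in>X. d (g x) (g y) = d x y) \<and>
              (\<forall>x\<in>A. g x = f x)))"

primrec gmul :: "nat \<Rightarrow> 'a::monoid_add \<Rightarrow> 'a" where
  "gmul 0 a = 0"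
| "gmul (Suc n) a = a + gmul n a"

definition is_value :: "('a::ab_group_add \<Rightarrow> real) \<Rightarrow> bool" where
  "is_value p \<longleftrightarrow> (\<forall>x. 0 \<le> p x) \<and> (\<forall>x. p x = 0 \<longleftrightarrow> x = 0) \<and> (\<forall>x. p (- x) = p x) \<and>
     (\<forall>x y. p (x + y) \<le> p x + p y)"

definition class_O0 :: "('a::ab_group_add \<Rightarrow> real) \<Rightarrow> bool" where
  "class_O0 p \<longleftrightarrow> (\<forall>a. (\<lambda>n. p (gmul n a) / real n) \<longlonglongrightarrow> 0)"

definition is_value_on :: "('b, 'c) monoid_scheme \<Rightarrow> ('b \<Rightarrow> real) \<Rightarrow> bool" where
  "is_value_on H q \<longleftrightarrow> (\<forall>x\<in>carrier H. 0 \<le> q x \<and> (q x = 0 \<longleftrightarrow> x = one H) \<and>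
      q (m_inv H x) = q x \<and> (\<forall>y\<in>carrier H. q (mult H x y) \<le> q x + q y))"

definition G1 :: "('a::ab_group_add \<Rightarrow> real) \<Rightarrow> ereal \<Rightarrow> nat \<Rightarrow> bool" where
  "G1 p r N \<longleftrightarrow> is_value p \<and>
     Metric_space.mcomplete UNIV (\<lambda>x y. p (x - y)) \<and>
     separable_space (Metric_space.mtopology UNIV (\<lambda>x y. p (x - y))) \<and>
     class_O0 p \<and> (\<forall>x. ereal (p x) \<le> r) \<and> (N \<noteq> 0 \<longrightarrow> (\<forall>x::'a. gmul N x = 0))"

text \<open>(G2): approximate extension property for finite valued Abelian groups.  Finite groups
  are represented (up to isomorphism) by HOL-Algebra groups whose carrier is a finite set of
  natural numbers.\<close>
definition G2 :: "('a::ab_group_add \<Rightarrow> real) \<Rightarrow> ereal \<Rightarrow> nat \<Rightarrow> bool" where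
  "G2 p r N \<longleftrightarrow>
    (\<forall>(H::nat monoid) q K (\<phi>::nat \<Rightarrow> 'a) \<epsilon>.
       comm_group H \<and> finite (carrier H) \<and> is_value_on H q \<and>
       (\<forall>x\<in>carrier H. ereal (q x) \<le> r) \<and>
       (N \<noteq> 0 \<longrightarrow> (\<forall>x\<in>carrier H. x [^]\<^bsub>H\<^esub> N = \<one>\<^bsub>H\<^esub>)) \<and>
       subgroup K H \<and>
       (\<forall>x\<in>K. \<forall>y\<in>K. \<phi> (x \<otimes>\<^bsub>H\<^esub> y) = \<phi> x + \<phi> y) \<and>
       (\<forall>x\<in>K. p (\<phi> x) = q x) \<and>
       0 < \<epsilon> \<and> \<epsilon> < 1 \<longrightarrow>
       (\<exists>\<psi>::nat \<Rightarrow> 'a.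
          (\<forall>x\<in>carrier H. \<forall>y\<in>carrier H. \<psi> (x \<otimes>\<^bsub>H\<^esub> y) = \<psi> x + \<psi> y) \<and>
          (\<forall>x\<in>K. p (\<phi> x - \<psi> x) \<le> \<epsilon>) \<and>
          (\<forall>x\<in>carrier H. (1 - \<epsilon>) * q x \<le> p (\<psi> x) \<and> p (\<psi> x) \<le> (1 + \<epsilon>) * q x)))"

definition G3 :: "('a::ab_group_add \<Rightarrow> real) \<Rightarrow> nat \<Rightarrow> bool" where
  "G3 p N \<longleftrightarrow> (N = 0 \<longrightarrow>
     (\<forall>x \<epsilon>. 0 < \<epsilon> \<longrightarrow> (\<exists>y. (\<exists>n>0. gmul n y = 0) \<and> p (x - y) < \<epsilon>)))"

end

theory Submission
  imports Defs
begin

text \<open>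
  A complete separable metric space is Urysohn as soon as every positive Katetov function on a
  finite subset is realised up to \<open>\<epsilon>\<close> by the distances to some point: completeness turns
  approximate into exact realisation, and a back-and-forth argument along countable dense sets
  does the rest.

  To realise a Katetov function \<open>f\<close> in the group, extend it to the whole group and approximate its
  domain by a finite subgroup \<open>K\<close>, using that torsion elements are dense. A value on
  \<open>K \<times> \<int>/m\<close> that extends \<open>p\<close> and gives \<open>z - k\<close> the value \<open>f k\<close>, where \<open>z\<close> is a generator of
  the second factor, is then realised by (G2). For \<open>N = 2\<close> take \<open>m = 2\<close>, where the Katetov
  inequalities are exactly the triangle inequality. For \<open>N = 0\<close> take the largest such value on
  \<open>K \<times> \<int>\<close>, truncate it at a bound \<open>M\<close> and pass to the quotient by \<open>m\<close>: the value at height \<open>j\<close>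
  is at least \<open>\<bar>j\<bar> min f\<close>, so for large \<open>m\<close> the quotient does not change heights \<open>0\<close> and \<open>\<plusminus>1\<close>.
\<close>

section \<open>A criterion for Urysohn spaces\<close>

text \<open>These are the functions that arise as distances from the points of \<open>A\<close> to
  one further point of a larger metric space. The value 0 is allowed and identifies the new point
  with a point of \<open>A\<close>.\<close>

definition katetov_on :: "'a set \<Rightarrow> ('a \<Rightarrow> 'a \<Rightarrow> real) \<Rightarrow> ('a \<Rightarrow> real) \<Rightarrow> bool" where
  "katetov_on A d f \<longleftrightarrow> (\<forall>a\<in>A. \<forall>b\<in>A. f a \<le> f b + d a b \<and> d a b \<le> f a + f b)"

text \<open>Partial isometries as relations, so that inverses and unions of chains are immediate.
  Between metric spaces such a relation is automatically single-valued and injective.\<close>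

definition isometric_rel :: "('b \<Rightarrow> 'b \<Rightarrow> real) \<Rightarrow> ('a \<Rightarrow> 'a \<Rightarrow> real) \<Rightarrow> ('b \<times> 'a) set \<Rightarrow> bool" where
  "isometric_rel e d R \<longleftrightarrow> (\<forall>(x, y)\<in>R. \<forall>(x', y')\<in>R. d y y' = e x x')"

lemma isometric_relD:
  "isometric_rel e d R \<Longrightarrow> (x, y) \<in> R \<Longrightarrow> (x', y') \<in> R \<Longrightarrow> d y y' = e x x'"
  unfolding isometric_rel_def by blast

section \<open>Exact realisation of Katetov functions in complete spaces\<close>

context Metric_space
begin

lemma limit_of_geometric_steps:
  assumes complete: mcomplete and z: "\<And>n. z n \<in> M"
    and step: "\<And>n. d (z n) (z (Suc n)) \<le> C / 2 ^ n"
  shows "\<exists>l\<in>M. (\<lambda>n. d (z n) l) \<longlonglongrightarrow> 0"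
proof -
  \<comment> \<open>The bound is the sum of \<open>C / 2 ^ i\<close> over
    \<open>n \<le> i < n + k\<close>; keeping the subtracted term lets the induction close.\<close>
  have far: "d (z n) (z (n + k)) \<le> 2 * C / 2 ^ n - 2 * C / 2 ^ (n + k)" for n k
  proof (induction k)
    case 0
    then show ?case using z by simp
  next
    case (Suc k)
    have "d (z n) (z (n + Suc k)) \<le> d (z n) (z (n + k)) + d (z (n + k)) (z (n + Suc k))"
      using triangle[OF z z z] by simp
    also have "\<dots> \<le> 2 * C / 2 ^ n - 2 * C / 2 ^ (n + k) + C / 2 ^ (n + k)"
      using Suc step[of "n + k"] by simp
    also have "\<dots> = 2 * C / 2 ^ n - 2 * C / 2 ^ (n + Suc k)"
      by (simp add: field_simps)
    finally show ?case .
  qed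
  have "0 \<le> C" using order_trans[OF nonneg step[of 0]] by simp
  then have bound: "d (z n) (z (n + k)) \<le> 2 * C / 2 ^ n" for n k
    using far[of n k] by (smt (verit) divide_nonneg_nonneg zero_le_power)
  have small: "(\<lambda>n. 2 * C / 2 ^ n) \<longlonglongrightarrow> 0"
    using LIMSEQ_divide_realpow_zero[of 2 "2 * C"] by simp
  have "MCauchy z"
    unfolding MCauchy_def
  proof (intro conjI allI impI)
    show "range z \<subseteq> M" using z by auto
    fix \<epsilon> :: real assume "0 < \<epsilon>"
    then obtain n0 where n0: "\<And>n. n \<ge> n0 \<Longrightarrow> 2 * C / 2 ^ n < \<epsilon>"
      using order_tendstoD(2)[OF small] eventually_sequentially by metis
    have "d (z n) (z n') < \<epsilon>" if "n0 \<le> n" "n \<le> n'" for n n'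
      using bound[of n "n' - n"] n0[OF that(1)] that by simp
    then show "\<exists>N. \<forall>n n'. N \<le> n \<longrightarrow> N \<le> n' \<longrightarrow> d (z n) (z n') < \<epsilon>"
      by (metis commute linorder_linear)
  qed
  then obtain l where "limitin mtopology z l sequentially"
    using complete unfolding mcomplete_def by blast
  then have "l \<in> M" and lim: "\<And>\<epsilon>. 0 < \<epsilon> \<Longrightarrow> \<exists>N. \<forall>n\<ge>N. d (z n) l < \<epsilon>"
    unfolding limit_metric_sequentially by blast+
  have "(\<lambda>n. d (z n) l) \<longlonglongrightarrow> 0"
    unfolding LIMSEQ_def dist_real_def using lim by simp
  then show ?thesis using \<open>l \<in> M\<close> by blast
qed

text \<open>Approximants of \<open>f\<close> found independently need not converge. Each current
  approximant is therefore added to the domain with a small prescribed distance, which forces the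
  next one to lie close to it.\<close>

lemma katetov_exact:
  assumes complete: mcomplete and r: "1 \<le> (r::ereal)"
    and approx: "\<And>A f \<epsilon>. \<lbrakk>finite A; A \<noteq> {}; A \<subseteq> M; katetov_on A d f;
          \<And>a. a \<in> A \<Longrightarrow> 0 < f a \<and> ereal (f a) \<le> r; 0 < \<epsilon>\<rbrakk>
        \<Longrightarrow> \<exists>z\<in>M. \<forall>a\<in>A. \<bar>d z a - f a\<bar> \<le> \<epsilon>"
    and A: "finite A" "A \<noteq> {}" "A \<subseteq> M" and f: "katetov_on A d f"
    and fr: "\<And>a. a \<in> A \<Longrightarrow> ereal (f a) \<le> r"
  shows "\<exists>z\<in>M. \<forall>a\<in>A. d z a = f a"
proof (cases "\<exists>a\<in>A. f a \<le> 0")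
  case True
  then obtain a0 where a0: "a0 \<in> A" "f a0 \<le> 0" by blast
  \<comment> \<open>With \<open>f a0 \<le> 0\<close> the Katetov inequalities squeeze
    \<open>f a\<close> to \<open>d a0 a\<close>, so \<open>a0\<close> itself realises
    \<open>f\<close>.\<close>
  have "d a0 a = f a" if "a \<in> A" for a
    using f a0 that commute[of a0 a] unfolding katetov_on_def
    by (smt (verit))
  then show ?thesis using a0 A by blast
next
  case False
  then have pos: "\<And>a. a \<in> A \<Longrightarrow> 0 < f a" by force
  \<comment> \<open>Being below every \<open>f a\<close> keeps approximants outside
    \<open>A\<close>; being at most 1 makes the prescribed distances admissible, since
    \<open>1 \<le> r\<close>.\<close>
  define \<delta> where "\<delta> = min 1 (Min (f ` A)) / 2"
  have \<delta>: "0 < \<delta>" "\<delta> \<le> 1" "\<And>a. a \<in> A \<Longrightarrow> \<delta> < f a"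
  proof -
    have "0 < Min (f ` A)" using A pos by simp
    then show "0 < \<delta>" "\<delta> \<le> 1" unfolding \<delta>_def by auto
    fix a assume "a \<in> A"
    then have "Min (f ` A) \<le> f a" using A by simp
    with \<open>0 < Min (f ` A)\<close> show "\<delta> < f a" unfolding \<delta>_def by simp
  qed
  define P where "P n z \<longleftrightarrow> z \<in> M \<and> (\<forall>a\<in>A. \<bar>d z a - f a\<bar> \<le> \<delta> / 2 ^ n)" for n :: nat and z
  have start: "\<exists>z. P 0 z"
    using approx[OF A f, of \<delta>] fr pos \<delta> unfolding P_def by auto
  have step: "\<exists>z'. P (Suc n) z' \<and> d z z' \<le> (2 * \<delta>) / 2 ^ n" if "P n z" for n z
  proof -
    define s where "s = \<delta> / 2 ^ n"
    have "0 < s" "s \<le> \<delta>" using \<delta> unfolding s_def by (auto simp: field_simps)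
    have z: "z \<in> M" "\<And>a. a \<in> A \<Longrightarrow> \<bar>d z a - f a\<bar> \<le> s"
      using that unfolding P_def s_def by auto
    have "z \<notin> A" using z(2)[of z] z(1) \<delta>(3)[of z] \<open>s \<le> \<delta>\<close> by force
    \<comment> \<open>The distance \<open>s\<close> prescribed at \<open>z\<close> equals the error
      bound of \<open>z\<close>, which is just enough for \<open>g\<close> to be Katetov on
      \<open>insert z A\<close>. Realising \<open>g\<close> up to \<open>s / 2\<close> then halves
      the error while moving by at most \<open>2 * s\<close>.\<close>
    define g where "g = f(z := s)"
    have gA: "g a = f a" if "a \<in> A" for a using that \<open>z \<notin> A\<close> by (auto simp: g_def)
    have gz: "g z = s" by (simp add: g_def)
    have az: "f a \<le> s + d a z \<and> s \<le> f a + d a z \<and> d a z \<le> f a + s \<and> d z a = d a z"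
      if "a \<in> A" for a
      using z(2)[OF that] \<delta>(3)[OF that] \<open>s \<le> \<delta>\<close> commute[of a z] nonneg[of a z] by linarith
    have "katetov_on (insert z A) d g"
      unfolding katetov_on_def
    proof (intro ballI)
      fix a b assume "a \<in> insert z A" "b \<in> insert z A"
      then consider "a = z" "b = z" | "a = z" "b \<in> A" | "a \<in> A" "b = z" | "a \<in> A" "b \<in> A" by blast
      then show "g a \<le> g b + d a b \<and> d a b \<le> g a + g b"
        using f az[of a] az[of b] z(1) \<open>0 < s\<close> gA[of a] gA[of b] gz unfolding katetov_on_def
        by cases auto
    qed
    moreover have "0 < g a \<and> ereal (g a) \<le> r" if "a \<in> insert z A" for a
    proof (cases "a = z")
      case True
      have "ereal s \<le> 1" using \<open>s \<le> \<delta>\<close> \<delta> by (simp add: one_ereal_def)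
      then have "ereal s \<le> r" using r by (rule order_trans)
      then show ?thesis using True gz \<open>0 < s\<close> by simp
    qed (use that gA pos fr in auto)
    ultimately obtain z' where z': "z' \<in> M" "\<forall>a\<in>insert z A. \<bar>d z' a - g a\<bar> \<le> s / 2"
      using approx[of "insert z A" g "s / 2"] A z(1) \<open>0 < s\<close> by auto
    have "P (Suc n) z'"
      using z' gA unfolding P_def s_def by (auto simp: field_simps)
    moreover have "\<bar>d z' z - s\<bar> \<le> s / 2" using z'(2) gz by simp
    then have "d z z' \<le> 2 * s" using commute[of z z'] \<open>0 < s\<close> by linarith
    ultimately show ?thesis unfolding s_def by (auto simp: field_simps)
  qed
  obtain z where z: "\<And>n. P n (z n)" "\<And>n. d (z n) (z (Suc n)) \<le> (2 * \<delta>) / 2 ^ n"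
    using dependent_nat_choice[of P "\<lambda>n z z'. d z z' \<le> (2 * \<delta>) / 2 ^ n"] start step by metis
  have zM: "z n \<in> M" for n using z(1) unfolding P_def by blast
  obtain l where l: "l \<in> M" "(\<lambda>n. d (z n) l) \<longlonglongrightarrow> 0"
    using limit_of_geometric_steps[OF complete zM z(2)] by blast
  have "d l a = f a" if "a \<in> A" for a
  proof -
    have aM: "a \<in> M" using that A by blast
    have "\<bar>d l a - f a\<bar> \<le> d (z n) l + \<delta> / 2 ^ n" for n
    proof -
      have "\<bar>d (z n) a - f a\<bar> \<le> \<delta> / 2 ^ n" using z(1) that unfolding P_def by blast
      moreover have "d (z n) a \<le> d (z n) l + d l a" using triangle zM l aM by blast
      moreover have "d l a \<le> d l (z n) + d (z n) a" using triangle zM l aM by blast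
      ultimately show ?thesis using commute[of l "z n"] by linarith
    qed
    moreover have "(\<lambda>n. d (z n) l + \<delta> / 2 ^ n) \<longlonglongrightarrow> 0"
      using tendsto_add[OF l(2) LIMSEQ_divide_realpow_zero[of 2 \<delta>]] by simp
    ultimately have "\<bar>d l a - f a\<bar> \<le> 0"
      by (intro LIMSEQ_le_const) auto
    then show ?thesis by simp
  qed
  then show ?thesis using l by blast
qed

section \<open>Extension of partial isometries\<close>

text \<open>If points of the domain converge to \<open>x\<close>, their partners form a Cauchy
  sequence because \<open>U\<close> preserves distances, and the limit serves as image of
  \<open>x\<close>. The single-point form can also be applied to the converse relation, to find
  preimages.\<close>

lemma isometric_rel_limit_point:
  assumes complete: mcomplete and S: "Metric_space S e"
    and U: "U \<subseteq> S \<times> M" "isometric_rel e d U"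
    and x: "x \<in> S" and dense: "\<forall>\<epsilon>>0. \<exists>(u, v)\<in>U. e x u < \<epsilon>"
  shows "\<exists>y\<in>M. \<forall>(u, v)\<in>U. d y v = e x u"
proof -
  interpret S: Metric_space S e by fact
  have "\<exists>u v. (u, v) \<in> U \<and> e x u < 1 / 2 ^ n" for n :: nat
    using dense[rule_format, of "1 / 2 ^ n"] by auto
  then obtain u v where uv: "\<And>n. (u n, v n) \<in> U" "\<And>n::nat. e x (u n) < 1 / 2 ^ n" by metis
  have uS: "u n \<in> S" and vM: "v n \<in> M" for n using uv(1)[of n] U by auto
  have "d (v n) (v (Suc n)) \<le> 2 / 2 ^ n" for n
  proof -
    have "d (v n) (v (Suc n)) = e (u n) (u (Suc n))" using isometric_relD[OF U(2) uv(1) uv(1)] .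
    also have "\<dots> \<le> e x (u n) + e x (u (Suc n))"
      using S.triangle[of "u n" x "u (Suc n)"] S.commute[of x "u n"] uS x by simp
    also have "\<dots> \<le> 1 / 2 ^ n + 1 / 2 ^ Suc n"
      using uv(2)[of n] uv(2)[of "Suc n"] by linarith
    also have "\<dots> \<le> 2 / 2 ^ n" by (simp add: field_simps)
    finally show ?thesis .
  qed
  then obtain y where y: "y \<in> M" "(\<lambda>n. d (v n) y) \<longlonglongrightarrow> 0"
    using limit_of_geometric_steps[of v 2, OF complete vM] by blast
  have "d y b = e x a" if "(a, b) \<in> U" for a b
  proof -
    have ab: "a \<in> S" "b \<in> M" using that U by auto
    have "\<bar>d y b - e x a\<bar> \<le> d (v n) y + 1 / 2 ^ n" for n
    proof -
      have "d (v n) b = e (u n) a" using isometric_relD[OF U(2) uv(1) that] .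
      moreover have "d (v n) b \<le> d (v n) y + d y b" using triangle vM y ab by blast
      moreover have "d y b \<le> d y (v n) + d (v n) b" using triangle vM y ab by blast
      moreover have "e (u n) a \<le> e (u n) x + e x a" using S.triangle uS x ab by blast
      moreover have "e x a \<le> e x (u n) + e (u n) a" using S.triangle uS x ab by blast
      ultimately show ?thesis
        using commute[of y "v n"] S.commute[of x "u n"] uv(2)[of n] by linarith
    qed
    moreover have "(\<lambda>n. d (v n) y + 1 / 2 ^ n) \<longlonglongrightarrow> 0"
      using tendsto_add[OF y(2) LIMSEQ_divide_realpow_zero[of 2 1]] by simp
    ultimately have "\<bar>d y b - e x a\<bar> \<le> 0"
      by (intro LIMSEQ_le_const) auto
    then show ?thesis by simp
  qed
  then show ?thesis using y by blast
qed

text \<open>Images are chosen pointwise by their distances to the range of \<open>U\<close>.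
  Comparing with a pair \<open>(u, v)\<close> where \<open>u\<close> is near \<open>y\<close> shows
  that the chosen map preserves distances.\<close>

lemma isometric_rel_extension:
  assumes complete: mcomplete and S: "Metric_space S e"
    and U: "U \<subseteq> S \<times> M" "isometric_rel e d U"
    and dense: "\<forall>x\<in>S. \<forall>\<epsilon>>0. \<exists>(u, v)\<in>U. e x u < \<epsilon>"
  shows "\<exists>g. g ` S \<subseteq> M \<and> (\<forall>x\<in>S. \<forall>y\<in>S. d (g x) (g y) = e x y) \<and> (\<forall>(x, y)\<in>U. g x = y)"
proof -
  interpret S: Metric_space S e by fact
  have "\<forall>x\<in>S. \<exists>y. y \<in> M \<and> (\<forall>(u, v)\<in>U. d y v = e x u)"
    using isometric_rel_limit_point[OF complete S U] dense by blast
  from bchoice[OF this] obtain g where gM: "\<And>x. x \<in> S \<Longrightarrow> g x \<in> M"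
    and g: "\<And>x u v. x \<in> S \<Longrightarrow> (u, v) \<in> U \<Longrightarrow> d (g x) v = e x u"
    by fast
  have "d (g x) (g y) = e x y" if xy: "x \<in> S" "y \<in> S" for x y
  proof -
    have "\<bar>d (g x) (g y) - e x y\<bar> \<le> \<epsilon>" if "0 < \<epsilon>" for \<epsilon>
    proof -
      obtain u v where uv: "(u, v) \<in> U" "e y u < \<epsilon> / 2"
        using dense[rule_format, OF xy(2), of "\<epsilon> / 2"] \<open>0 < \<epsilon>\<close> by auto
      then have "u \<in> S" "v \<in> M" using U by auto
      have "d (g x) v = e x u" "d (g y) v = e y u" using g uv xy by auto
      moreover have "d (g x) (g y) \<le> d (g x) v + d v (g y)" "d (g x) v \<le> d (g x) (g y) + d (g y) v"
        using triangle gM xy \<open>v \<in> M\<close> by blast+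
      moreover have "e x y \<le> e x u + e u y" "e x u \<le> e x y + e y u"
        using S.triangle xy \<open>u \<in> S\<close> by blast+
      ultimately show ?thesis
        using uv(2) commute[of v "g y"] S.commute[of u y] by linarith
    qed
    then have "\<bar>d (g x) (g y) - e x y\<bar> \<le> 0" by (rule dense_ge)
    then show ?thesis by simp
  qed
  moreover have "g x = y" if "(x, y) \<in> U" for x y
  proof -
    have "x \<in> S" "y \<in> M" using U that by auto
    then show ?thesis using g[OF _ that] gM by (metis S.mdist_zero zero)
  qed
  ultimately show ?thesis using gM by blast
qed

text \<open>The image of \<open>x\<close> must realise the distances from \<open>x\<close> carried
  over along \<open>R\<close>; these form a Katetov function by the triangle inequality in
  \<open>S\<close>.\<close>

lemma isometric_rel_insert:
  assumes exact: "\<And>A f. \<lbrakk>finite A; A \<noteq> {}; A \<subseteq> M; katetov_on A d f;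
          \<And>a. a \<in> A \<Longrightarrow> ereal (f a) \<le> r\<rbrakk> \<Longrightarrow> \<exists>z\<in>M. \<forall>a\<in>A. d z a = f a"
    and "M \<noteq> {}" and S: "Metric_space S e"
    and er: "\<And>x y. \<lbrakk>x \<in> S; y \<in> S\<rbrakk> \<Longrightarrow> ereal (e x y) \<le> r"
    and R: "finite R" "R \<subseteq> S \<times> M" "isometric_rel e d R" and x: "x \<in> S"
  shows "\<exists>y\<in>M. isometric_rel e d (insert (x, y) R)"
proof -
  interpret S: Metric_space S e by fact
  \<comment> \<open>Injectivity of \<open>R\<close>, a consequence of isometry, makes the choice of
    the preimage immaterial.\<close>
  define f where "f b = e x (SOME a. (a, b) \<in> R)" for b
  have f: "f b = e x a" if ab: "(a, b) \<in> R" for a b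
  proof -
    define a' where "a' = (SOME a. (a, b) \<in> R)"
    have a': "(a', b) \<in> R" unfolding a'_def using ab by (rule someI)
    have "e a' a = d b b" using isometric_relD[OF R(3) a' ab] by simp
    moreover have "a \<in> S" "a' \<in> S" "b \<in> M" using ab a' R by auto
    ultimately have "a' = a" by simp
    then show ?thesis by (simp add: f_def a'_def)
  qed
  have "\<exists>y\<in>M. \<forall>b\<in>snd ` R. d y b = f b"
  proof (cases "R = {}")
    case False
    have "katetov_on (snd ` R) d f"
      unfolding katetov_on_def
    proof (clarsimp)
      fix a b a' b' assume ab: "(a, b) \<in> R" "(a', b') \<in> R"
      then have "a \<in> S" "a' \<in> S" using R by auto
      then show "f b \<le> f b' + d b b' \<and> d b b' \<le> f b + f b'"
        using f[OF ab(1)] f[OF ab(2)] isometric_relD[OF R(3) ab]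
          S.triangle[of x a' a] S.triangle[of a x a'] S.commute[of a x] S.commute[of a a'] x
        by auto
    qed
    moreover have "ereal (f b) \<le> r" if "b \<in> snd ` R" for b
      using that f er x R(2) by force
    moreover have "snd ` R \<subseteq> M" using R by auto
    ultimately show ?thesis using exact[of "snd ` R" f] R(1) False by blast
  qed (use \<open>M \<noteq> {}\<close> in auto)
  then obtain y where y: "y \<in> M" "\<And>a b. (a, b) \<in> R \<Longrightarrow> d y b = e x a" using f by force
  have "d b y = e a x" if "(a, b) \<in> R" for a b
    using y(2)[OF that] commute[of b y] S.commute[of a x] by simp
  then have "isometric_rel e d (insert (x, y) R)"
    using y R(3) x unfolding isometric_rel_def by auto
  then show ?thesis using y by blast
qed

lemma separable_dense_sequence:
  assumes "separable_space mtopology" "M \<noteq> {}"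
  shows "\<exists>c :: nat \<Rightarrow> 'a. range c \<subseteq> M \<and> (\<forall>x\<in>M. \<forall>\<epsilon>>0. \<exists>n. d x (c n) < \<epsilon>)"
proof -
  obtain C where C: "countable C" "C \<subseteq> M" "Abstract_Topology.closure_of mtopology C = M"
    using assms(1) unfolding separable_space_def by auto
  have dense: "\<exists>y\<in>C. d x y < \<epsilon>" if "x \<in> M" "0 < \<epsilon>" for x \<epsilon>
    using that C(3) unfolding metric_closure_of by fastforce
  then have "C \<noteq> {}" using assms(2) zero_less_one by blast
  then have "range (from_nat_into C) = C" using C(1) by simp
  then show ?thesis using dense C(2) by (metis rangeE)
qed

end

section \<open>Back and forth\<close>

text \<open>Stage \<open>n\<close> fulfils \<open>task n\<close>, and the union of the stages stays
  isometric because any two pairs lie in a common stage. As \<open>task\<close> need not be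
  monotone, it is asserted for a subset of \<open>U\<close>.\<close>

lemma isometric_rel_chain:
  assumes R0: "finite R0" "R0 \<subseteq> S \<times> M" "isometric_rel e d R0"
    and step: "\<And>(n::nat) R. \<lbrakk>finite R; R \<subseteq> S \<times> M; isometric_rel e d R\<rbrakk> \<Longrightarrow>
        \<exists>R'. finite R' \<and> R' \<subseteq> S \<times> M \<and> isometric_rel e d R' \<and> R \<subseteq> R' \<and> task n R'"
  shows "\<exists>U. U \<subseteq> S \<times> M \<and> isometric_rel e d U \<and> R0 \<subseteq> U \<and> (\<forall>n. \<exists>R'\<subseteq>U. task n R')"
proof -
  define P where "P n R \<longleftrightarrow> finite R \<and> R \<subseteq> S \<times> M \<and> isometric_rel e d R \<and> R0 \<subseteq> R"
    for n :: nat and R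
  have "\<exists>f. \<forall>n. P n (f n) \<and> (f n \<subseteq> f (Suc n) \<and> task n (f (Suc n)))"
  proof (rule dependent_nat_choice)
    show "\<exists>R. P 0 R" using R0 unfolding P_def by blast
    show "\<exists>R'. P (Suc n) R' \<and> R \<subseteq> R' \<and> task n R'" if "P n R" for R n
      using step[of R n] that unfolding P_def by blast
  qed
  then obtain F where F: "\<And>n. P n (F n)" "\<And>n. F n \<subseteq> F (Suc n)" "\<And>n. task n (F (Suc n))" by blast
  have mono: "F m \<subseteq> F n" if "m \<le> n" for m n using lift_Suc_mono_le[of F, OF F(2) that] .
  have "isometric_rel e d (\<Union>n. F n)"
    unfolding isometric_rel_def
  proof clarify
    fix x y x' y' m n assume "(x, y) \<in> F m" "(x', y') \<in> F n"
    then have "(x, y) \<in> F (max m n)" "(x', y') \<in> F (max m n)"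
      using mono[of m "max m n"] mono[of n "max m n"] by auto
    then show "d y y' = e x x'" using F(1) isometric_relD unfolding P_def by metis
  qed
  moreover have "(\<Union>n. F n) \<subseteq> S \<times> M" "R0 \<subseteq> (\<Union>n. F n)" using F(1) unfolding P_def by blast+
  ultimately show ?thesis using F(3) by (intro exI[of _ "\<Union>n. F n"]) blast
qed

lemma le_metric_diam: "x \<in> S \<Longrightarrow> y \<in> S \<Longrightarrow> ereal (e x y) \<le> metric_diam S e"
  unfolding metric_diam_def by (meson SUP_upper2 order_refl)

lemma (in Metric_space) Urysohn_criterion:
  assumes complete: mcomplete and sep: "separable_space mtopology" and "M \<noteq> {}"
    and r: "1 \<le> (r::ereal)" and dr: "\<And>x y. \<lbrakk>x \<in> M; y \<in> M\<rbrakk> \<Longrightarrow> ereal (d x y) \<le> r"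
    and approx: "\<And>A f \<epsilon>. \<lbrakk>finite A; A \<noteq> {}; A \<subseteq> M; katetov_on A d f;
          \<And>a. a \<in> A \<Longrightarrow> 0 < f a \<and> ereal (f a) \<le> r; 0 < \<epsilon>\<rbrakk>
        \<Longrightarrow> \<exists>z\<in>M. \<forall>a\<in>A. \<bar>d z a - f a\<bar> \<le> \<epsilon>"
  shows "Urysohn T M d"
  unfolding Urysohn_def
proof (intro conjI allI impI)
  have exact: "\<exists>z\<in>M. \<forall>a\<in>A. d z a = f a"
    if "finite A" "A \<noteq> {}" "A \<subseteq> M" "katetov_on A d f" "\<And>a. a \<in> A \<Longrightarrow> ereal (f a) \<le> r" for A f
    using katetov_exact[OF complete r approx that] by blast
  show "Metric_space M d" by (rule Metric_space_axioms)
  show mcomplete "separable_space mtopology" by fact+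
  show "\<exists>f. f ` S \<subseteq> M \<and> (\<forall>x\<in>S. \<forall>y\<in>S. d (f x) (f y) = e x y)"
    if asm: "Metric_space S e \<and> separable_space (Metric_space.mtopology S e) \<and>
         metric_diam S e \<le> metric_diam M d" for S :: "'b set" and e
  proof (cases "S = {}")
    case False
    interpret S: Metric_space S e using asm by blast
    \<comment> \<open>The diameter condition of (U1) turns into the bound \<open>r\<close> on the
      distances of \<open>S\<close>, which is what one-point extension requires.\<close>
    have "metric_diam M d \<le> r" unfolding metric_diam_def using dr by (intro SUP_least)
    then have er: "ereal (e x y) \<le> r" if "x \<in> S" "y \<in> S" for x y
      using asm le_metric_diam[of x S y e] that by force
    obtain c :: "nat \<Rightarrow> 'b" where c: "range c \<subseteq> S" "\<And>x \<epsilon>. x \<in> S \<Longrightarrow> 0 < \<epsilon> \<Longrightarrow> \<exists>n. e x (c n) < \<epsilon>"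
      using S.separable_dense_sequence asm False by blast
    \<comment> \<open>For an embedding going forth is enough: only the domain has to become
      dense.\<close>
    have "\<exists>U. U \<subseteq> S \<times> M \<and> isometric_rel e d U \<and> {} \<subseteq> U \<and> (\<forall>n. \<exists>R'\<subseteq>U. c n \<in> Domain R')"
    proof (rule isometric_rel_chain)
      fix n R assume R: "finite R" "R \<subseteq> S \<times> M" "isometric_rel e d R"
      have cS: "c n \<in> S" using c by auto
      then obtain y where "y \<in> M" "isometric_rel e d (insert (c n, y) R)"
        using isometric_rel_insert[OF exact \<open>M \<noteq> {}\<close> S.Metric_space_axioms er R cS] by blast
      then show "\<exists>R'. finite R' \<and> R' \<subseteq> S \<times> M \<and> isometric_rel e d R' \<and> R \<subseteq> R' \<and> c n \<in> Domain R'"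
        using R cS by (intro exI[of _ "insert (c n, y) R"]) auto
    qed (simp_all add: isometric_rel_def)
    then obtain U where U: "U \<subseteq> S \<times> M" "isometric_rel e d U"
      and cU: "\<forall>n. \<exists>R'\<subseteq>U. c n \<in> Domain R'" by (elim exE conjE)
    have DU: "c n \<in> Domain U" for n using cU by blast
    have "\<forall>x\<in>S. \<forall>\<epsilon>>0. \<exists>(u, v)\<in>U. e x u < \<epsilon>"
    proof (intro ballI allI impI)
      show "\<exists>(u, v)\<in>U. e x u < \<epsilon>" if "x \<in> S" "0 < \<epsilon>" for x \<epsilon>
        using c(2)[OF that] DU by blast
    qed
    from isometric_rel_extension[OF complete S.Metric_space_axioms U(1,2) this]
    show ?thesis by blast
  qed auto
  show "\<exists>g. bij_betw g M M \<and> (\<forall>x\<in>M. \<forall>y\<in>M. d (g x) (g y) = d x y) \<and> (\<forall>x\<in>A. g x = f x)"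
    if asm: "A \<subseteq> M \<and> B \<subseteq> M \<and> finite A \<and> finite B \<and> bij_betw f A B \<and>
         (\<forall>x\<in>A. \<forall>y\<in>A. d (f x) (f y) = d x y)" for A B f
  proof -
    obtain c :: "nat \<Rightarrow> 'a" where c: "range c \<subseteq> M" "\<And>x \<epsilon>. x \<in> M \<Longrightarrow> 0 < \<epsilon> \<Longrightarrow> \<exists>n. d x (c n) < \<epsilon>"
      using separable_dense_sequence sep \<open>M \<noteq> {}\<close> by blast
    have insert: "\<exists>y\<in>M. isometric_rel d d (insert (x, y) R)"
      if "finite R" "R \<subseteq> M \<times> M" "isometric_rel d d R" "x \<in> M" for R x
      using isometric_rel_insert[OF exact \<open>M \<noteq> {}\<close> Metric_space_axioms dr that] by blast
    have converse: "isometric_rel d d (R\<inverse>)" if "isometric_rel d d R" for R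
    proof -
      have "d x x' = d y y'" if "(x, y) \<in> R" "(x', y') \<in> R" for x y x' y'
        using isometric_relD[OF \<open>isometric_rel d d R\<close> that] by simp
      then show ?thesis unfolding isometric_rel_def by blast
    qed
    have fB: "f ` A = B" using asm bij_betw_imp_surj_on by blast
    have "\<exists>U. U \<subseteq> M \<times> M \<and> isometric_rel d d U \<and> (\<lambda>a. (a, f a)) ` A \<subseteq> U \<and>
        (\<forall>n. \<exists>R'\<subseteq>U. c n \<in> Domain R' \<and> c n \<in> Range R')"
    proof (rule isometric_rel_chain)
      fix n R assume R: "finite R" "R \<subseteq> M \<times> M" "isometric_rel d d R"
      have cM: "c n \<in> M" using c by auto
      then obtain y where y: "y \<in> M" "isometric_rel d d (insert (c n, y) R)"
        using insert[OF R cM] by blast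
      define R1 where "R1 = insert (c n, y) R"
      have R1: "finite R1" "R1 \<subseteq> M \<times> M" "isometric_rel d d R1" using R y cM by (auto simp: R1_def)
      \<comment> \<open>The back step is the forth step applied to the converse relation.\<close>
      then have "finite (R1\<inverse>)" "R1\<inverse> \<subseteq> M \<times> M" "isometric_rel d d (R1\<inverse>)" using converse by auto
      from insert[OF this cM] obtain x where x: "x \<in> M" "isometric_rel d d (insert (c n, x) (R1\<inverse>))"
        by blast
      have "(insert (c n, x) (R1\<inverse>))\<inverse> = insert (x, c n) R1" by auto
      then have "isometric_rel d d (insert (x, c n) R1)" using converse[OF x(2)] by simp
      then show "\<exists>R'. finite R' \<and> R' \<subseteq> M \<times> M \<and> isometric_rel d d R' \<and> R \<subseteq> R' \<and>
          c n \<in> Domain R' \<and> c n \<in> Range R'"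
        using R1 x cM by (intro exI[of _ "insert (x, c n) R1"]) (auto simp: R1_def)
    qed (use asm fB in \<open>simp_all add: isometric_rel_def, blast\<close>)
    then obtain U where U: "U \<subseteq> M \<times> M" "isometric_rel d d U" "(\<lambda>a. (a, f a)) ` A \<subseteq> U"
      and cU: "\<forall>n. \<exists>R'\<subseteq>U. c n \<in> Domain R' \<and> c n \<in> Range R'" by (elim exE conjE)
    have DU: "c n \<in> Domain U" and RU: "c n \<in> Range U" for n using cU by blast+
    have dense: "\<forall>x\<in>M. \<forall>\<epsilon>>0. \<exists>(u, v)\<in>U. d x u < \<epsilon>"
    proof (intro ballI allI impI)
      show "\<exists>(u, v)\<in>U. d x u < \<epsilon>" if "x \<in> M" "0 < \<epsilon>" for x \<epsilon>
        using c(2)[OF that] DU by blast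
    qed
    have dense': "\<forall>\<epsilon>>0. \<exists>(u, v)\<in>U\<inverse>. d x u < \<epsilon>" if "x \<in> M" for x
    proof (intro allI impI)
      show "\<exists>(u, v)\<in>U\<inverse>. d x u < \<epsilon>" if "0 < \<epsilon>" for \<epsilon>
        using c(2)[OF \<open>x \<in> M\<close> that] RU by blast
    qed
    from isometric_rel_extension[OF complete Metric_space_axioms U(1,2) dense]
    obtain g where gM: "g ` M \<subseteq> M" and gd: "\<forall>x\<in>M. \<forall>y\<in>M. d (g x) (g y) = d x y"
      and gU: "\<forall>(x, y)\<in>U. g x = y" by (elim exE conjE)
    have gU': "g x = y" if "(x, y) \<in> U" for x y using bspec[OF gU that] by simp
    have "inj_on g M" by (rule inj_onI) (metis gd mdist_zero zero)
    \<comment> \<open>The preimage \<open>x\<close> of \<open>y\<close> is a limit point for the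
      converse of \<open>U\<close>. Then \<open>g x\<close> and \<open>y\<close> have the same
      distances to the range of \<open>U\<close>, which is dense, and so they coincide.\<close>
    moreover have "y \<in> g ` M" if y: "y \<in> M" for y
    proof -
      have "U\<inverse> \<subseteq> M \<times> M" using U(1) by auto
      from isometric_rel_limit_point[OF complete Metric_space_axioms this converse[OF U(2)] y dense'[OF y]]
      obtain x where "x \<in> M" and xU: "\<forall>(v, u)\<in>U\<inverse>. d x u = d y v" by (elim bexE)
      have x: "d x u = d y v" if "(u, v) \<in> U" for u v
        using bspec[OF xU converseI[OF that]] by simp
      have gx: "g x \<in> M" using gM \<open>x \<in> M\<close> by blast
      have "d (g x) y \<le> \<epsilon>" if "0 < \<epsilon>" for \<epsilon>
      proof -
        obtain u v where uv: "(u, v) \<in> U" "d y v < \<epsilon> / 2"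
          using dense'[OF y, rule_format, of "\<epsilon> / 2"] \<open>0 < \<epsilon>\<close> by auto
        have "u \<in> M" "v \<in> M" using U(1) uv by auto
        have "d (g x) v = d y v" using gd \<open>x \<in> M\<close> \<open>u \<in> M\<close> gU'[OF uv(1)] x[OF uv(1)] by metis
        then show ?thesis
          using triangle[OF gx \<open>v \<in> M\<close> y] commute[of v y] uv(2) by linarith
      qed
      then have "d (g x) y \<le> 0" by (rule dense_ge)
      then have "d (g x) y = 0" using nonneg[of "g x" y] by (rule antisym)
      then have "g x = y" using zero[OF gx y] by (rule iffD1[rotated])
      then show ?thesis using \<open>x \<in> M\<close> by blast
    qed
    ultimately have "bij_betw g M M" using gM unfolding bij_betw_def by blast
    moreover have "\<forall>x\<in>A. g x = f x" using gU' U(3) by blast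
    ultimately show ?thesis using gd by blast
  qed
qed

section \<open>Values and finite cyclic extensions\<close>

lemma is_valueD:
  assumes "is_value p"
  shows "0 \<le> p x" "p x = 0 \<longleftrightarrow> x = 0" "p (- x) = p x" "p (x + y) \<le> p x + p y"
    "p (x - y) = p (y - x)" "p (x - z) \<le> p (x - y) + p (y - z)"
proof -
  show "0 \<le> p x" "p x = 0 \<longleftrightarrow> x = 0" "p (- x) = p x" "p (x + y) \<le> p x + p y"
    using assms unfolding is_value_def by auto
  show "p (x - y) = p (y - x)" using assms unfolding is_value_def by (metis minus_diff_eq)
  have "(x - y) + (y - z) = x - z" by simp
  then show "p (x - z) \<le> p (x - y) + p (y - z)" using assms unfolding is_value_def by metis
qed

lemma is_value_Metric_space: "is_value p \<Longrightarrow> Metric_space UNIV (\<lambda>x y. p (x - y))"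
  by unfold_locales (simp_all add: is_valueD)

definition add_subgroup :: "'a::ab_group_add set \<Rightarrow> bool" where
  "add_subgroup K \<longleftrightarrow> 0 \<in> K \<and> (\<forall>x\<in>K. \<forall>y\<in>K. x - y \<in> K)"

lemma add_subgroupD:
  assumes "add_subgroup K"
  shows "0 \<in> K" "x \<in> K \<Longrightarrow> - x \<in> K" "x \<in> K \<Longrightarrow> y \<in> K \<Longrightarrow> x + y \<in> K"
proof -
  show "0 \<in> K" using assms unfolding add_subgroup_def by blast
  have neg: "- x \<in> K" if "x \<in> K" for x
    using assms that unfolding add_subgroup_def by (metis diff_0)
  then show "x \<in> K \<Longrightarrow> - x \<in> K" by blast
  show "x \<in> K \<Longrightarrow> y \<in> K \<Longrightarrow> x + y \<in> K"
    using assms neg unfolding add_subgroup_def by (metis diff_minus_eq_add)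
qed

lemma gmul_in_add_subgroup: "add_subgroup K \<Longrightarrow> x \<in> K \<Longrightarrow> gmul n x \<in> K"
  by (induction n) (auto intro: add_subgroupD)

lemma gmul_plus: "gmul (m + n) x = gmul m x + gmul n (x :: 'a::monoid_add)"
  by (induction m) (auto simp: add.assoc)

lemma gmul_mod:
  fixes x :: "'a::monoid_add"
  assumes "gmul n x = 0"
  shows "gmul (i mod n) x = gmul i x"
proof -
  have "gmul (k * n) x = 0" for k by (induction k) (auto simp: gmul_plus assms)
  then show ?thesis using gmul_plus[of "i div n * n" "i mod n" x] by simp
qed

text \<open>Torsion elements are adjoined one at a time: if \<open>a\<close> is annihilated by
  \<open>n\<close>, then the multiples \<open>gmul i a\<close> with \<open>i < n\<close> suffice to
  enlarge \<open>K\<close>, which keeps it finite.\<close>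

lemma finite_torsion_subgroup:
  assumes "finite A" "\<And>a. a \<in> A \<Longrightarrow> \<exists>n>0. gmul n a = 0"
  shows "\<exists>K. finite K \<and> add_subgroup K \<and> A \<subseteq> K"
  using assms
proof (induction A rule: finite_induct)
  case empty
  show ?case by (intro exI[of _ "{0}"]) (auto simp: add_subgroup_def)
next
  case (insert a A)
  then obtain K where K: "finite K" "add_subgroup K" "A \<subseteq> K" by auto
  obtain n where n: "n > 0" "gmul n a = 0" using insert.prems by blast
  define K' where "K' = {k + gmul i a |k i. k \<in> K \<and> i < n}"
  have in_K': "k + gmul i a \<in> K'" if "k \<in> K" for k i
  proof -
    have "k + gmul (i mod n) a \<in> K'" unfolding K'_def using that mod_less_divisor[OF n(1), of i] by blast
    then show ?thesis using gmul_mod[OF n(2)] by simp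
  qed
  have "x - y \<in> K'" if xy: "x \<in> K'" "y \<in> K'" for x y
  proof -
    obtain k i where ki: "x = k + gmul i a" "k \<in> K" using xy(1) unfolding K'_def by blast
    obtain l j where lj: "y = l + gmul j a" "l \<in> K" "j < n" using xy(2) unfolding K'_def by blast
    \<comment> \<open>As \<open>gmul\<close> takes natural multiples only, the negative of
      \<open>gmul j a\<close> is expressed as \<open>gmul (n - j) a\<close>.\<close>
    have "gmul (n - j) a + gmul j a = 0" using gmul_plus[of "n - j" j a] lj(3) n(2) by simp
    then have "gmul (n - j) a = - gmul j a" by (simp add: eq_neg_iff_add_eq_0)
    then have "gmul (i + (n - j)) a = gmul i a - gmul j a"
      by (simp only: gmul_plus diff_conv_add_uminus)
    then have "x - y = (k - l) + gmul (i + (n - j)) a" using ki lj by simp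
    moreover have "k - l \<in> K" using ki lj K(2) unfolding add_subgroup_def by blast
    ultimately show ?thesis using in_K' by metis
  qed
  moreover have "k \<in> K'" if "k \<in> K" for k using in_K'[OF that, of 0] by simp
  moreover have "a \<in> K'" using in_K'[of 0 1] K(2) by (simp add: add_subgroup_def)
  moreover have "finite K'" using K(1) unfolding K'_def by (intro finite_image_set2) auto
  ultimately show ?case using K(2,3) by (intro exI[of _ K']) (auto simp: add_subgroup_def)
qed

text \<open>Here \<open>Q\<close> is a value on the group \<open>K \<times> \<int>/m\<close>, written as a function on \<open>K \<times> \<int>\<close> that
  is \<open>m\<close>-periodic in the second argument.\<close>
lemma G2_cyclic_extension:
  fixes p :: "'a::ab_group_add \<Rightarrow> real" and Q :: "'a \<Rightarrow> int \<Rightarrow> real" and m :: nat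
  assumes G2: "G2 p r N" and K: "finite K" "add_subgroup K" and m: "0 < m"
    and periodic: "\<And>g j. Q g (j mod int m) = Q g j"
    and nonneg: "\<And>g j. 0 \<le> Q g j"
    and zero: "\<And>g j. g \<in> K \<Longrightarrow> Q g j = 0 \<longleftrightarrow> g = 0 \<and> j mod int m = 0"
    and minus: "\<And>g j. Q (- g) (- j) = Q g j"
    and plus: "\<And>g h i j. Q (g + h) (i + j) \<le> Q g i + Q h j"
    and le: "\<And>g j. g \<in> K \<Longrightarrow> ereal (Q g j) \<le> r"
    and exponent: "N \<noteq> 0 \<Longrightarrow> (\<forall>g\<in>K. gmul N g = 0) \<and> m dvd N"
    and base: "\<And>k. k \<in> K \<Longrightarrow> Q k 0 = p k"
    and \<epsilon>: "0 < \<epsilon>" "\<epsilon> < 1"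
  shows "\<exists>\<theta> w. \<forall>k\<in>K. p (k - \<theta> k) \<le> \<epsilon> \<and>
    (1 - \<epsilon>) * Q k 1 \<le> p (\<theta> k + w) \<and> p (\<theta> k + w) \<le> (1 + \<epsilon>) * Q k 1"
proof -
  note KD = add_subgroupD[OF K(2)]
  define C where "C = K \<times> {0..<int m}"
  have C: "(g, j mod int m) \<in> C \<longleftrightarrow> g \<in> K" for g j using m by (simp add: C_def)
  have "finite C" using K(1) by (simp add: C_def)
  \<comment> \<open>\<open>G2\<close> speaks of groups carried by natural numbers, so the finite
    group \<open>K \<times> \<int>/m\<close> is transported along an injection.\<close>
  then obtain enc :: "'a \<times> int \<Rightarrow> nat" where enc: "inj_on enc C"
    using finite_imp_inj_to_nat_seg by blast
  define dec where "dec = inv_into C enc"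
  have dec: "dec (enc x) = x" if "x \<in> C" for x using inv_into_f_f[OF enc that] by (simp add: dec_def)
  define H :: "nat monoid" where "H = \<lparr>carrier = enc ` C,
    mult = (\<lambda>x y. enc (fst (dec x) + fst (dec y), (snd (dec x) + snd (dec y)) mod int m)),
    one = enc (0, 0)\<rparr>"
  \<comment> \<open>Reducing the second coordinate here allows arbitrary integers as heights and
    keeps \<open>mod\<close> out of the group laws.\<close>
  define E where "E g j = enc (g, j mod int m)" for g j
  define q where "q x = Q (fst (dec x)) (snd (dec x))" for x
  have E_mod: "E g (j mod int m) = E g j" for g j by (simp add: E_def)
  have decE: "dec (E g j) = (g, j mod int m)" if "g \<in> K" for g j
    using that C dec by (simp add: E_def)
  have mult: "E g i \<otimes>\<^bsub>H\<^esub> E h j = E (g + h) (i + j)" if "g \<in> K" "h \<in> K" for g h i j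
    using decE that by (simp add: H_def E_def mod_add_eq)
  have one: "\<one>\<^bsub>H\<^esub> = E 0 0" by (simp add: H_def E_def)
  have carrier: "x \<in> carrier H \<longleftrightarrow> (\<exists>g\<in>K. \<exists>j. x = E g j)" for x
  proof
    assume "x \<in> carrier H"
    then obtain y where "y \<in> C" "x = enc y" by (auto simp: H_def)
    then have "fst y \<in> K" "x = E (fst y) (snd y)" by (auto simp: C_def E_def)
    then show "\<exists>g\<in>K. \<exists>j. x = E g j" by blast
  qed (use C in \<open>auto simp: E_def H_def\<close>)
  have E_eq: "E g i = E h j \<longleftrightarrow> g = h \<and> i mod int m = j mod int m" if "g \<in> K" "h \<in> K" for g h i j
    using decE[OF that(1), of i] decE[OF that(2), of j] by (metis E_def Pair_inject)
  have H: "comm_group H"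
  proof (rule comm_groupI)
    fix x y z assume "x \<in> carrier H" "y \<in> carrier H" "z \<in> carrier H"
    then obtain g i h j k l where *: "x = E g i" "y = E h j" "z = E k l" "g \<in> K" "h \<in> K" "k \<in> K"
      unfolding carrier by blast
    show "x \<otimes>\<^bsub>H\<^esub> y \<in> carrier H" "x \<otimes>\<^bsub>H\<^esub> y = y \<otimes>\<^bsub>H\<^esub> x" "\<one>\<^bsub>H\<^esub> \<otimes>\<^bsub>H\<^esub> x = x"
      "(x \<otimes>\<^bsub>H\<^esub> y) \<otimes>\<^bsub>H\<^esub> z = x \<otimes>\<^bsub>H\<^esub> (y \<otimes>\<^bsub>H\<^esub> z)"
      using * KD carrier by (auto simp: mult one add_ac)
    have "E (- g) (- i) \<otimes>\<^bsub>H\<^esub> x = \<one>\<^bsub>H\<^esub>" using * KD by (simp add: mult one)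
    then show "\<exists>y\<in>carrier H. y \<otimes>\<^bsub>H\<^esub> x = \<one>\<^bsub>H\<^esub>" using carrier KD * by blast
  qed (use carrier one KD in auto)
  then interpret H: comm_group H .
  have inv: "inv\<^bsub>H\<^esub> (E g j) = E (- g) (- j)" if "g \<in> K" for g j
    by (rule H.inv_equality) (use that KD carrier in \<open>auto simp: mult one\<close>)
  have qE: "q (E g j) = Q g j" if "g \<in> K" for g j using that by (simp add: q_def decE periodic)
  \<comment> \<open>\<open>K'\<close> is the copy of \<open>K\<close> at height 0. By
    \<open>base\<close> the projection \<open>fst (dec x)\<close> is isometric on it, and this is
    the homomorphism fed into \<open>G2\<close>.\<close>
  define K' where "K' = (\<lambda>k. E k 0) ` K"
  have "is_value_on H q"
    unfolding is_value_on_def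
  proof (intro ballI conjI)
    fix x y assume "x \<in> carrier H" "y \<in> carrier H"
    then obtain g i h j where *: "x = E g i" "y = E h j" "g \<in> K" "h \<in> K" unfolding carrier by blast
    show "0 \<le> q x" "q (inv\<^bsub>H\<^esub> x) = q x" "q (x \<otimes>\<^bsub>H\<^esub> y) \<le> q x + q y" "(q x = 0) = (x = \<one>\<^bsub>H\<^esub>)"
      using * KD by (auto simp: qE inv mult one E_eq nonneg minus plus zero)
  qed
  moreover have "ereal (q x) \<le> r" if "x \<in> carrier H" for x using that carrier qE le by auto
  moreover have "x [^]\<^bsub>H\<^esub> N = \<one>\<^bsub>H\<^esub>" if N: "N \<noteq> 0" and x: "x \<in> carrier H" for x
  proof -
    obtain g j where gj: "g \<in> K" "x = E g j" using x unfolding carrier by blast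
    have "x [^]\<^bsub>H\<^esub> n = E (gmul n g) (int n * j)" for n :: nat
      by (induction n) (use gj gmul_in_add_subgroup[OF K(2)] in
          \<open>auto simp: one mult algebra_simps\<close>)
    then show ?thesis using exponent[OF N] gj KD by (simp add: one E_eq)
  qed
  moreover have "subgroup K' H"
  proof (rule H.subgroupI)
    show "K' \<subseteq> carrier H" "K' \<noteq> {}" using carrier KD by (auto simp: K'_def)
    show "inv\<^bsub>H\<^esub> x \<in> K'" if "x \<in> K'" for x using that KD by (auto simp: K'_def inv)
    show "x \<otimes>\<^bsub>H\<^esub> y \<in> K'" if "x \<in> K'" "y \<in> K'" for x y using that KD by (auto simp: K'_def mult)
  qed
  moreover have "\<forall>x\<in>K'. \<forall>y\<in>K'. fst (dec (x \<otimes>\<^bsub>H\<^esub> y)) = fst (dec x) + fst (dec y)"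
    using KD by (auto simp: K'_def mult decE)
  moreover have "\<forall>x\<in>K'. p (fst (dec x)) = q x" by (auto simp: K'_def decE qE base)
  moreover have "finite (carrier H)" using \<open>finite C\<close> by (simp add: H_def)
  ultimately have "\<exists>\<psi>. (\<forall>x\<in>carrier H. \<forall>y\<in>carrier H. \<psi> (x \<otimes>\<^bsub>H\<^esub> y) = \<psi> x + \<psi> y) \<and>
      (\<forall>x\<in>K'. p (fst (dec x) - \<psi> x) \<le> \<epsilon>) \<and>
      (\<forall>x\<in>carrier H. (1 - \<epsilon>) * q x \<le> p (\<psi> x) \<and> p (\<psi> x) \<le> (1 + \<epsilon>) * q x)"
    using H \<epsilon> by (intro G2[unfolded G2_def, rule_format]) blast
  then obtain \<psi>
    where \<psi>: "\<And>x y. x \<in> carrier H \<Longrightarrow> y \<in> carrier H \<Longrightarrow> \<psi> (x \<otimes>\<^bsub>H\<^esub> y) = \<psi> x + \<psi> y"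
      "\<And>x. x \<in> K' \<Longrightarrow> p (fst (dec x) - \<psi> x) \<le> \<epsilon>"
      "\<And>x. x \<in> carrier H \<Longrightarrow> (1 - \<epsilon>) * q x \<le> p (\<psi> x) \<and> p (\<psi> x) \<le> (1 + \<epsilon>) * q x"
    by (elim exE conjE) (rule that; blast)
  \<comment> \<open>The element at height 1 over \<open>k\<close> is the sum of \<open>E k 0\<close>
    and the generator \<open>E 0 1\<close>; their images under \<open>\<psi>\<close> are the
    required \<open>\<theta> k\<close> and \<open>w\<close>.\<close>
  have "p (k - \<psi> (E k 0)) \<le> \<epsilon> \<and> (1 - \<epsilon>) * Q k 1 \<le> p (\<psi> (E k 0) + \<psi> (E 0 1)) \<and>
      p (\<psi> (E k 0) + \<psi> (E 0 1)) \<le> (1 + \<epsilon>) * Q k 1" if "k \<in> K" for k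
  proof -
    have "\<psi> (E k 1) = \<psi> (E k 0) + \<psi> (E 0 1)"
      using \<psi>(1)[of "E k 0" "E 0 1"] that KD carrier by (auto simp: mult)
    then show ?thesis
      using \<psi>(2)[of "E k 0"] \<psi>(3)[of "E k 1"] that carrier by (auto simp: K'_def decE qE)
  qed
  then show ?thesis by (intro exI[of _ "\<lambda>k. \<psi> (E k 0)"] exI[of _ "\<psi> (E 0 1)"]) blast
qed

section \<open>Values extending a Katetov function\<close>

text \<open>Here \<open>f\<close> is Katetov on the whole group, so the infima below may range over
  all shifts. The uniform bound \<open>c\<close> keeps nonzero heights away from 0.\<close>

locale katetov_value =
  fixes p f :: "'a::ab_group_add \<Rightarrow> real" and c :: real
  assumes val: "is_value p"
    and katetov: "f a \<le> f b + p (a - b)" "p (a - b) \<le> f a + f b"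
    and c: "0 < c" "c \<le> f a"
begin

text \<open>\<open>F n g\<close> is the largest possible value of \<open>n z + g\<close>, given that \<open>p\<close> is the value on the
  base group and each \<open>z + a\<close> has value \<open>f a\<close>.\<close>
primrec F :: "nat \<Rightarrow> 'a \<Rightarrow> real" where
  "F 0 = p"
| "F (Suc n) = (\<lambda>g. INF a. f a + F n (g - a))"

lemma le_F_Suc: "(\<And>a. x \<le> f a + F n (g - a)) \<Longrightarrow> x \<le> F (Suc n) g"
  by (auto intro: cINF_greatest)

text \<open>Each unit of height costs some \<open>f a\<close>, hence at least \<open>c\<close>. This
  linear growth also supplies the lower bounds that make the infima meaningful.\<close>

lemma F_ge: "c * real n \<le> F n g"
proof (induction n arbitrary: g)
  case (Suc n)
  show ?case
    by (rule le_F_Suc) (use Suc c(2) in \<open>auto simp: algebra_simps intro: add_mono\<close>)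
qed (simp add: is_valueD[OF val])

lemma F_Suc_le: "F (Suc n) g \<le> f a + F n (g - a)"
proof -
  have "0 \<le> f b + F n (g - b)" for b
    using F_ge[of n "g - b"] c(1) c(2)[of b] by (smt (verit) mult_nonneg_nonneg of_nat_0_le_iff)
  then have "bdd_below (range (\<lambda>b. f b + F n (g - b)))" by (intro bdd_belowI2)
  then show ?thesis by (auto intro: cINF_lower)
qed

text \<open>By the first Katetov inequality no detour \<open>f a + p (g - a)\<close> is cheaper than
  \<open>f g\<close>, so the prescribed values survive.\<close>

lemma F_1: "F 1 g = f g"
proof (rule antisym)
  show "F 1 g \<le> f g" using F_Suc_le[of 0 g g] is_valueD(2)[OF val, of 0] by simp
  have "f g \<le> F (Suc 0) g" by (rule le_F_Suc) (simp add: katetov)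
  then show "f g \<le> F 1 g" by simp
qed

lemma F_lipschitz: "F n (g + h) \<le> F n g + p h"
proof (induction n arbitrary: g)
  case (Suc n)
  have "F (Suc n) (g + h) - p h \<le> F (Suc n) g"
  proof (rule le_F_Suc)
    fix a
    show "F (Suc n) (g + h) - p h \<le> f a + F n (g - a)"
      using F_Suc_le[of n "g + h" a] Suc[of "g - a"] by (simp add: algebra_simps)
  qed
  then show ?case by simp
qed (simp add: is_valueD[OF val])

lemma F_plus: "F (m + n) (g + h) \<le> F m g + F n h"
proof (induction m arbitrary: g)
  case 0
  show ?case using F_lipschitz[of n h g] by (simp add: add.commute)
next
  case (Suc m)
  have "F (Suc m + n) (g + h) - F n h \<le> F (Suc m) g"
  proof (rule le_F_Suc)
    fix a
    show "F (Suc m + n) (g + h) - F n h \<le> f a + F m (g - a)"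
      using F_Suc_le[of "m + n" "g + h" a] Suc[of "g - a"] by (simp add: algebra_simps)
  qed
  then show ?case by simp
qed

text \<open>A step up by \<open>z + b\<close> followed by a step down by \<open>z + a\<close>
  amounts to the base element \<open>b - a\<close>, whose value is at most \<open>f b + f a\<close>
  by the second Katetov inequality.\<close>

lemma F_pred: "F n g \<le> F (Suc n) (g + a) + f a"
proof -
  have "F n g - f a \<le> F (Suc n) (g + a)"
  proof (rule le_F_Suc)
    fix b
    show "F n g - f a \<le> f b + F n (g + a - b)"
      using F_lipschitz[of n "g + a - b" "b - a"] katetov(2)[of b a] by simp
  qed
  then show ?thesis by simp
qed

text \<open>Iterating the single step down gives the triangle inequality for summands whose heights
  have opposite signs.\<close>

lemma F_minus: "F n g \<le> F (n + m) (g + h) + F m h"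
proof (induction m arbitrary: h)
  case 0
  show ?case
    using F_lipschitz[of n "g + h" "- h"] by (simp add: is_valueD[OF val])
next
  case (Suc m)
  have "F n g - F (n + Suc m) (g + h) \<le> F (Suc m) h"
  proof (rule le_F_Suc)
    fix a
    show "F n g - F (n + Suc m) (g + h) \<le> f a + F m (h - a)"
      using F_pred[of "n + m" "g + (h - a)" a] Suc[of "h - a"] by (simp add: algebra_simps)
  qed
  then show ?case by simp
qed

text \<open>The extension to negative heights is dictated by symmetry; at height 0 both formulas
  agree because \<open>p (- g) = p g\<close>.\<close>

definition G :: "'a \<Rightarrow> int \<Rightarrow> real" where
  "G g j = (if 0 \<le> j then F (nat j) g else F (nat (- j)) (- g))"

lemma G_of_nat: "G g (int n) = F n g" "G g (- int n) = F n (- g)"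
  by (auto simp: G_def is_valueD[OF val])

lemma G_minus: "G (- g) (- j) = G g j"
  by (cases j rule: int_cases2) (simp_all add: G_of_nat)

lemma G_ge: "c * \<bar>j\<bar> \<le> G g j"
  by (cases j rule: int_cases2) (simp_all add: G_of_nat F_ge)

lemma G_plus: "G (g + h) (i + j) \<le> G g i + G h j"
proof -
  have mixed: "G (g + h) (int m + - int n) \<le> G g (int m) + G h (- int n)" for g h m n
  proof (cases "n \<le> m")
    case True
    then have eq: "int m + - int n = int (m - n)" by simp
    show ?thesis
      unfolding eq G_of_nat using F_minus[of "m - n" "g + h" n "- h"] True by simp
  next
    case False
    then have eq: "int m + - int n = - int (n - m)" by simp
    show ?thesis
      unfolding eq G_of_nat using F_minus[of "n - m" "- (g + h)" m g] False by simp
  qed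
  show ?thesis
  proof (cases i rule: int_cases2; cases j rule: int_cases2)
    fix m n assume ij: "i = int m" "j = int n"
    show ?thesis using F_plus[of m n g h] G_of_nat(1)[of "g + h" "m + n"] by (simp add: ij G_of_nat)
  next
    fix m n assume ij: "i = - int m" "j = - int n"
    show ?thesis
      using F_plus[of m n "- g" "- h"] G_of_nat(2)[of "g + h" "m + n"] by (simp add: ij G_of_nat)
  next
    fix m n assume ij: "i = int m" "j = - int n"
    show ?thesis using mixed[of g h m n] by (simp add: ij)
  next
    fix m n assume ij: "i = - int m" "j = int n"
    show ?thesis using mixed[of h g n m] by (simp add: ij add_ac)
  qed
qed

section \<open>Truncation and passage to the quotient\<close>

text \<open>The quotient value of the truncated \<open>min M (G g j)\<close> modulo the subgroup of
  heights divisible by \<open>m\<close>: the infimum over a residue class.\<close>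

definition Q :: "real \<Rightarrow> nat \<Rightarrow> 'a \<Rightarrow> int \<Rightarrow> real" where
  "Q M m g j = (INF i. min M (G g (j + int m * i)))"

text \<open>For \<open>\<bar>j\<bar> \<le> 1\<close> and \<open>i \<noteq> 0\<close> the height
  \<open>j + m * i\<close> has absolute value at least \<open>m - 1\<close>; hence the form of the
  bound on \<open>M\<close>.\<close>

context
  fixes M :: real and m :: nat
  assumes M: "0 < M" and m: "M \<le> c * (real m - 1)"
begin

lemma G_nonneg: "0 \<le> G g j"
  using G_ge[of j g] c(1) by (smt (verit) mult_nonneg_nonneg of_int_0_le_iff)

lemma Q_le: "Q M m g j \<le> min M (G g (j + int m * i))"
proof -
  have "bdd_below (range (\<lambda>i. min M (G g (j + int m * i))))"
    using M G_nonneg by (intro bdd_belowI2[of _ 0]) auto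
  then show ?thesis unfolding Q_def by (rule cINF_lower) simp
qed

lemma le_Q: "(\<And>i. x \<le> min M (G g (j + int m * i))) \<Longrightarrow> x \<le> Q M m g j"
  unfolding Q_def by (auto intro: cINF_greatest)

lemma Q_nonneg: "0 \<le> Q M m g j"
  using M G_nonneg by (intro le_Q) auto

lemma Q_le_M: "Q M m g j \<le> M"
  using Q_le[of g j 0] by simp

lemma Q_shift: "Q M m g (j + int m * k) = Q M m g j"
proof -
  have *: "Q M m g (j + int m * k) \<le> Q M m g j" for j k
  proof (rule le_Q)
    fix i
    show "Q M m g (j + int m * k) \<le> min M (G g (j + int m * i))"
      using Q_le[of g "j + int m * k" "i - k"] by (simp add: algebra_simps)
  qed
  show ?thesis using *[of j k] *[of "j + int m * k" "- k"] by simp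
qed

lemma Q_periodic: "Q M m g (j mod int m) = Q M m g j"
  using Q_shift[of g "j mod int m" "j div int m"] by simp

lemma Q_minus: "Q M m (- g) (- j) = Q M m g j"
proof -
  have *: "Q M m (- g) (- j) \<le> Q M m g j" for g j
  proof (rule le_Q)
    fix i
    have "- j + int m * - i = - (j + int m * i)" by simp
    then show "Q M m (- g) (- j) \<le> min M (G g (j + int m * i))"
      using Q_le[of "- g" "- j" "- i"] by (simp only: G_minus)
  qed
  show ?thesis using *[of g j] *[of "- g" "- j"] by simp
qed

lemma Q_plus: "Q M m (g + h) (i + j) \<le> Q M m g i + Q M m h j"
proof -
  \<comment> \<open>Representatives with indices \<open>s\<close> and \<open>t\<close> add up to the
    one with index \<open>s + t\<close>; truncation keeps the inequality because \<open>G\<close> is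
    nonnegative.\<close>
  have *: "Q M m (g + h) (i + j) \<le> min M (G g (i + int m * s)) + min M (G h (j + int m * t))" for s t
  proof -
    have "Q M m (g + h) (i + j) \<le> min M (G (g + h) ((i + int m * s) + (j + int m * t)))"
      using Q_le[of "g + h" "i + j" "s + t"] by (simp add: algebra_simps)
    also have "\<dots> \<le> min M (G g (i + int m * s)) + min M (G h (j + int m * t))"
      using G_plus[of g h "i + int m * s" "j + int m * t"] M
        G_nonneg[of g "i + int m * s"] G_nonneg[of h "j + int m * t"] by linarith
    finally show ?thesis .
  qed
  have "Q M m (g + h) (i + j) - Q M m g i \<le> Q M m h j"
  proof (rule le_Q)
    fix t
    have "Q M m (g + h) (i + j) - min M (G h (j + int m * t)) \<le> Q M m g i"
    proof (rule le_Q)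
      fix s
      show "Q M m (g + h) (i + j) - min M (G h (j + int m * t)) \<le> min M (G g (i + int m * s))"
        using *[of s t] by linarith
    qed
    then show "Q M m (g + h) (i + j) - Q M m g i \<le> min M (G h (j + int m * t))" by linarith
  qed
  then show ?thesis by simp
qed

text \<open>\<open>m\<close> is so large that all other representatives of the residue class of \<open>j\<close> are truncated
  to \<open>M\<close>.\<close>
lemma Q_eq_G:
  assumes "\<bar>j\<bar> \<le> 1" "G g j \<le> M"
  shows "Q M m g j = G g j"
proof (rule antisym)
  show "Q M m g j \<le> G g j" using Q_le[of g j 0] by simp
  show "G g j \<le> Q M m g j"
  proof (rule le_Q)
    fix i
    show "G g j \<le> min M (G g (j + int m * i))"
    proof (cases "i = 0")
      case False
      then have "int m * 1 \<le> int m * \<bar>i\<bar>" by (intro mult_left_mono) auto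
      then have "int m - 1 \<le> \<bar>j + int m * i\<bar>" using assms(1) by (simp add: abs_mult[symmetric])
      then have "c * (real m - 1) \<le> c * \<bar>j + int m * i\<bar>" using c(1) by (intro mult_left_mono) linarith+
      then show ?thesis using m G_ge[of "j + int m * i" g] assms(2) by linarith
    qed (use assms in auto)
  qed
qed

text \<open>At residue 0 truncation does not affect \<open>p g\<close>. At any other residue all
  representatives have nonzero height, so the infimum is at least \<open>min M c\<close>.\<close>

lemma Q_eq_0_iff:
  assumes "p g \<le> M"
  shows "Q M m g j = 0 \<longleftrightarrow> g = 0 \<and> j mod int m = 0"
proof (cases "j mod int m = 0")
  case True
  then have "Q M m g j = G g 0" using Q_periodic[of g j] Q_eq_G[of 0 g] assms by (simp add: G_def)
  then show ?thesis using True by (simp add: G_def is_valueD(2)[OF val])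
next
  case False
  have "min M c \<le> Q M m g j"
  proof (rule le_Q)
    fix i
    have "j + int m * i \<noteq> 0" using False by (metis mod_0 mod_mult_self2)
    then have "c * 1 \<le> c * \<bar>j + int m * i\<bar>" using c(1) by (intro mult_left_mono) linarith+
    then show "min M c \<le> min M (G g (j + int m * i))" using G_ge[of "j + int m * i" g] by linarith
  qed
  then show ?thesis using False M c(1) by linarith
qed

end

section \<open>Approximate realisation in the group\<close>

lemma realise_on_finite_subgroup:
  assumes G2: "G2 p r N" and N: "N = 0 \<or> N = 2 \<and> (\<forall>x::'a. gmul N x = 0)"
    and K: "finite K" "add_subgroup K"
    and M: "0 < M" "ereal M \<le> r" "\<And>k. k \<in> K \<Longrightarrow> p k \<le> M \<and> f k \<le> M" and "0 < \<epsilon>"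
  shows "\<exists>z. \<forall>k\<in>K. \<bar>p (z - k) - f k\<bar> \<le> \<epsilon>"
proof -
  \<comment> \<open>Replacing \<open>k\<close> by \<open>\<theta> k\<close> costs
    \<open>\<epsilon>'\<close>, and the relative error of \<open>G2\<close> costs at most
    \<open>\<epsilon>' * M\<close>; the sum must stay below \<open>\<epsilon>\<close>. The
    \<open>1 / 2\<close> ensures \<open>\<epsilon>' < 1\<close>.\<close>
  define \<epsilon>' where "\<epsilon>' = min (1 / 2) (\<epsilon> / (1 + M))"
  have \<epsilon>': "0 < \<epsilon>'" "\<epsilon>' < 1" using \<open>0 < \<epsilon>\<close> M(1) by (auto simp: \<epsilon>'_def)
  have "\<epsilon>' * (1 + M) \<le> \<epsilon> / (1 + M) * (1 + M)"
    using M(1) by (intro mult_right_mono) (auto simp: \<epsilon>'_def)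
  then have \<epsilon>'_le: "\<epsilon>' + \<epsilon>' * M \<le> \<epsilon>" using M(1) by (simp add: distrib_left[of \<epsilon>'])
  have le_r: "ereal x \<le> r" if "x \<le> M" for x
    using that M(2) by (meson ereal_less_eq(3) order_trans)
  have "\<exists>\<theta> w. \<forall>k\<in>K. p (k - \<theta> k) \<le> \<epsilon>' \<and>
      (1 - \<epsilon>') * f k \<le> p (\<theta> k + w) \<and> p (\<theta> k + w) \<le> (1 + \<epsilon>') * f k"
  proof (cases "N = 0")
    case True
    \<comment> \<open>This \<open>n\<close> is the modulus of the cyclic factor, chosen so that
      \<open>M \<le> c * (n - 1)\<close>.\<close>
    obtain n :: nat where "M / c + 1 \<le> real n" using real_arch_simple by blast
    moreover have "0 < M / c" using M(1) c(1) by simp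
    ultimately have "0 < real n" "M / c \<le> real n - 1" by linarith+
    then have n: "0 < n" "M \<le> c * (real n - 1)" using c(1) by (auto simp: field_simps)
    note Q_rules = Q_periodic[OF M(1) n(2)] Q_nonneg[OF M(1) n(2)] Q_eq_0_iff[OF M(1) n(2)]
      Q_minus[OF M(1) n(2)] Q_plus[OF M(1) n(2)] Q_le_M[OF M(1) n(2)] Q_eq_G[OF M(1) n(2)]
    have G1: "G g 1 = f g" for g using F_1[of g] by (simp add: G_def)
    have "\<exists>\<theta> w. \<forall>k\<in>K. p (k - \<theta> k) \<le> \<epsilon>' \<and>
        (1 - \<epsilon>') * Q M n k 1 \<le> p (\<theta> k + w) \<and> p (\<theta> k + w) \<le> (1 + \<epsilon>') * Q M n k 1"
      by (rule G2_cyclic_extension[OF G2 K n(1) _ _ _ _ _ _ _ _ \<epsilon>', where Q = "Q M n"])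
        (use M True le_r in \<open>auto simp: Q_rules G_def\<close>)
    then show ?thesis using Q_rules(7)[of 1] G1 M(3) by auto
  next
    case False
    then have N2: "N = 2" "x + x = 0" for x :: 'a using N by (auto simp: numeral_2_eq_2)
    then have minus: "- x = x" for x :: 'a by (metis add_eq_0_iff)
    \<comment> \<open>On \<open>K \<times> \<int>/2\<close> the parity of the height decides between
      \<open>p\<close> and \<open>f\<close>. As \<open>- x = x\<close>, the Katetov inequalities are
      the triangle inequalities between heights.\<close>
    define P where "P g j = (if even j then p g else f g)" for g :: 'a and j :: int
    have f_pos: "0 < f x" for x using c(1) c(2)[of x] by linarith
    have sub: "x - y = x + y" for x y :: 'a
      using minus[of y] by (metis diff_conv_add_uminus)
    have "\<exists>\<theta> w. \<forall>k\<in>K. p (k - \<theta> k) \<le> \<epsilon>' \<and>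
        (1 - \<epsilon>') * P k 1 \<le> p (\<theta> k + w) \<and> p (\<theta> k + w) \<le> (1 + \<epsilon>') * P k 1"
    proof (rule G2_cyclic_extension[OF G2 K, where Q = P and m = 2])
      show "P g (j mod int 2) = P g j" for g j by (simp add: P_def even_iff_mod_2_eq_zero)
      show "0 \<le> P g j" for g j using f_pos[of g] by (simp add: P_def is_valueD[OF val])
      show "P g j = 0 \<longleftrightarrow> g = 0 \<and> j mod int 2 = 0" for g j
        using f_pos[of g] is_valueD(2)[OF val, of g] by (auto simp: P_def even_iff_mod_2_eq_zero)
      show "P (- g) (- j) = P g j" for g j using minus[of g] by (simp add: P_def)
      show "P (g + h) (i + j) \<le> P g i + P h j" for g h i j
      proof -
        have "p (g + h) \<le> f g + f h" using katetov(2)[of g h] by (simp add: sub)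
        moreover have "f (g + h) \<le> f g + p h" using katetov(1)[of "g + h" g] by simp
        moreover have "f (g + h) \<le> p g + f h" using katetov(1)[of "g + h" h] by simp
        ultimately show ?thesis using is_valueD(4)[OF val, of g h] by (simp add: P_def)
      qed
      show "ereal (P g j) \<le> r" if "g \<in> K" for g j using M(3)[OF that] le_r by (simp add: P_def)
      show "(\<forall>g\<in>K. gmul N g = 0) \<and> 2 dvd N" if "N \<noteq> 0" using N that by auto
    qed (use \<epsilon>' in \<open>auto simp: P_def\<close>)
    then show ?thesis by (simp add: P_def)
  qed
  then obtain \<theta> w where \<theta>: "\<And>k. k \<in> K \<Longrightarrow> p (k - \<theta> k) \<le> \<epsilon>'"
    "\<And>k. k \<in> K \<Longrightarrow> (1 - \<epsilon>') * f k \<le> p (\<theta> k + w) \<and> p (\<theta> k + w) \<le> (1 + \<epsilon>') * f k" by blast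
  \<comment> \<open>The value of \<open>k + w\<close> is close to \<open>f k\<close>, so by symmetry
    the point at the right distances is \<open>- w\<close>.\<close>
  have "\<bar>p (- w - k) - f k\<bar> \<le> \<epsilon>" if "k \<in> K" for k
  proof -
    have "- w - k = - (k + w)" by simp
    then have "p (- w - k) = p (k + w)" by (simp only: is_valueD(3)[OF val])
    moreover have "\<bar>p (k + w) - p (\<theta> k + w)\<bar> \<le> \<epsilon>'"
      using \<theta>(1)[OF that] is_valueD(4)[OF val, of "k - \<theta> k" "\<theta> k + w"]
        is_valueD(4)[OF val, of "\<theta> k - k" "k + w"] is_valueD(5)[OF val, of k "\<theta> k"] by simp
    moreover have "\<epsilon>' * f k \<le> \<epsilon>' * M" using M(3)[OF that] \<epsilon>' by (intro mult_left_mono) auto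
    moreover have "f k - \<epsilon>' * f k \<le> p (\<theta> k + w) \<and> p (\<theta> k + w) \<le> f k + \<epsilon>' * f k"
      using \<theta>(2)[OF that] by (simp add: algebra_simps)
    ultimately show ?thesis using \<epsilon>'_le by linarith
  qed
  then show ?thesis by blast
qed

end

section \<open>From finite sets to finite subgroups\<close>

text \<open>The largest 1-Lipschitz extension, \<open>Min\<close> over \<open>a \<in> A\<close> of
  \<open>f a + d x a\<close>, stays Katetov and keeps every lower bound of \<open>f\<close>.\<close>

lemma (in Metric_space) katetov_extension:
  assumes A: "finite A" "A \<noteq> {}" "A \<subseteq> M" and f: "katetov_on A d f" "\<And>a. a \<in> A \<Longrightarrow> c \<le> f a"
  shows "\<exists>f'. katetov_on M d f' \<and> (\<forall>a\<in>A. f' a = f a) \<and> (\<forall>x\<in>M. c \<le> f' x)"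
proof -
  define f' where "f' x = Min ((\<lambda>a. f a + d x a) ` A)" for x
  have le: "f' x \<le> f a + d x a" if "a \<in> A" for x a using that A(1) by (simp add: f'_def)
  have attained: "\<exists>a\<in>A. f' x = f a + d x a" for x
  proof -
    have "f' x \<in> (\<lambda>a. f a + d x a) ` A" unfolding f'_def using A by (intro Min_in) auto
    then show ?thesis by blast
  qed
  have AM: "a \<in> M" if "a \<in> A" for a using that A by blast
  have "f' x \<le> f' y + d x y \<and> d x y \<le> f' x + f' y" if xy: "x \<in> M" "y \<in> M" for x y
  proof -
    obtain a b where ab: "a \<in> A" "f' x = f a + d x a" "b \<in> A" "f' y = f b + d y b"
      using attained by metis
    have "d x b \<le> d x y + d y b" using triangle xy AM ab by blast
    moreover have "d x y \<le> d x a + d a y" "d a y \<le> d a b + d b y" using triangle xy AM ab by blast+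
    moreover have "d a b \<le> f a + f b" using f ab by (simp add: katetov_on_def)
    ultimately show ?thesis using le[OF ab(3), of x] ab commute[of b y] by linarith
  qed
  then have "katetov_on M d f'" unfolding katetov_on_def by blast
  moreover have "f' a = f a" if "a \<in> A" for a
  proof -
    obtain b where b: "b \<in> A" "f' a = f b + d a b" using attained by metis
    have "f a \<le> f b + d a b" using f(1) that b(1) by (simp add: katetov_on_def)
    moreover have "d a a = 0" using AM[OF that] by simp
    ultimately show ?thesis using le[OF that, of a] b by simp
  qed
  moreover have "c \<le> f' x" for x
    using attained[of x] f(2) nonneg by (metis add_increasing2 )
  ultimately show ?thesis by blast
qed

theorem theorem5p1:
  fixes p :: "'a::ab_group_add \<Rightarrow> real" and r :: ereal and N :: nat
  assumes "r \<in> {1, \<infinity>}" and "N \<in> {0, 2}"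
    and "G1 p r N" and "G2 p r N" and "G3 p N"
  shows "Urysohn TYPE('b) (UNIV :: 'a set) (\<lambda>x y. p (x - y))"
proof -
  let ?d = "\<lambda>x y. p (x - y)"
  have val: "is_value p" and complete: "Metric_space.mcomplete UNIV ?d"
    and sep: "separable_space (Metric_space.mtopology UNIV ?d)"
    and pr: "\<And>x. ereal (p x) \<le> r" and exponent: "N \<noteq> 0 \<Longrightarrow> gmul N x = 0" for x :: 'a
    using assms(3) unfolding G1_def by auto
  interpret Metric_space UNIV ?d by (rule is_value_Metric_space[OF val])
  have torsion_dense: "\<exists>y. (\<exists>n>0. gmul n y = 0) \<and> p (x - y) < \<epsilon>" if "0 < \<epsilon>" for x \<epsilon>
  proof (cases "N = 0")
    case True
    then show ?thesis using assms(5) that unfolding G3_def by blast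
  next
    case False
    then show ?thesis
      using exponent[of x] is_valueD(2)[OF val, of "x - x"] that by (intro exI[of _ x]) auto
  qed
  have "\<exists>z\<in>UNIV. \<forall>a\<in>A. \<bar>p (z - a) - f a\<bar> \<le> \<epsilon>"
    if A: "finite A" "A \<noteq> {}" and f: "katetov_on A ?d f" "\<And>a. a \<in> A \<Longrightarrow> 0 < f a \<and> ereal (f a) \<le> r"
      and \<epsilon>: "0 < \<epsilon>" for A f \<epsilon>
  proof -
    \<comment> \<open>The cap at 1 makes \<open>c\<close> a lower bound also after the truncation in
      \<open>f1\<close>.\<close>
    define c where "c = min 1 (Min (f ` A))"
    have c: "0 < c" "c \<le> 1" "\<And>a. a \<in> A \<Longrightarrow> c \<le> f a"
      using A f(2) by (auto simp: c_def min_le_iff_disj)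
    obtain f0 where f0: "katetov_on UNIV ?d f0" "\<And>a. a \<in> A \<Longrightarrow> f0 a = f a" "\<And>x. c \<le> f0 x"
      using katetov_extension[OF A _ f(1) c(3)] by auto
    \<comment> \<open>For \<open>r = 1\<close> the extension may exceed the bound. Truncation at 1
      preserves the Katetov inequalities since \<open>p \<le> 1\<close>, and changes nothing on
      \<open>A\<close>.\<close>
    define f1 where "f1 x = (if r = \<infinity> then f0 x else min 1 (f0 x))" for x
    have p1: "p x \<le> 1" if "r \<noteq> \<infinity>" for x using pr[of x] that assms(1) by (auto simp: one_ereal_def)
    have f1: "f1 a = f a" if "a \<in> A" for a
      using f0(2) f(2) that assms(1) by (auto simp: f1_def one_ereal_def)
    interpret katetov_value p f1 c
    proof
      fix a b
      have "f0 a \<le> f0 b + p (a - b)" "p (a - b) \<le> f0 a + f0 b"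
        using f0(1) unfolding katetov_on_def by auto
      moreover have "0 \<le> p (a - b)" by (rule is_valueD(1)[OF val])
      moreover have "0 \<le> f0 a" "0 \<le> f0 b" using f0(3)[of a] f0(3)[of b] c(1) by linarith+
      ultimately have "f1 a \<le> f1 b + p (a - b) \<and> p (a - b) \<le> f1 a + f1 b"
        using p1[of "a - b"] unfolding f1_def min_def by (smt (verit))
      then show "f1 a \<le> f1 b + p (a - b)" "p (a - b) \<le> f1 a + f1 b" by blast+
      show "c \<le> f1 a" using f0(3) c(2) by (simp add: f1_def)
    qed (use val c in auto)
    \<comment> \<open>The three thirds of \<open>\<epsilon>\<close> are the changes of
      \<open>p (z - a)\<close> and of \<open>f1 a\<close> when \<open>a\<close> is replaced by the
      torsion element \<open>t a\<close>, and the error of realising \<open>f1\<close> on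
      \<open>K\<close>.\<close>
    have "\<forall>a\<in>A. \<exists>y. (\<exists>n>0. gmul n y = 0) \<and> p (a - y) < \<epsilon> / 3" using torsion_dense[of "\<epsilon> / 3"] \<epsilon> by (metis divide_pos_pos zero_less_numeral)
    from bchoice[OF this] obtain t where t: "\<And>a. a \<in> A \<Longrightarrow> \<exists>n>0. gmul n (t a) = 0"
      "\<And>a. a \<in> A \<Longrightarrow> p (a - t a) < \<epsilon> / 3" by blast
    obtain K where K: "finite K" "add_subgroup K" "t ` A \<subseteq> K"
      using finite_torsion_subgroup[of "t ` A"] A(1) t(1) by blast
    have "\<exists>M>0. ereal M \<le> r \<and> (\<forall>k\<in>K. p k \<le> M \<and> f1 k \<le> M)"
    proof (cases "r = \<infinity>")
      case True
      \<comment> \<open>The inserted 1 makes \<open>M\<close> positive.\<close>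
      define M where "M = Max (insert 1 (p ` K \<union> f1 ` K))"
      have "x \<le> M" if "x \<in> insert 1 (p ` K \<union> f1 ` K)" for x
        unfolding M_def using K(1) that by (intro Max_ge) auto
      then show ?thesis using True by (intro exI[of _ M]) fastforce
    next
      case False
      then have "r = 1" using assms(1) by simp
      then show ?thesis using p1 False by (intro exI[of _ 1]) (auto simp: f1_def one_ereal_def)
    qed
    then obtain M where M: "0 < M" "ereal M \<le> r" "\<And>k. k \<in> K \<Longrightarrow> p k \<le> M \<and> f1 k \<le> M" by blast
    have N: "N = 0 \<or> N = 2 \<and> (\<forall>x::'a. gmul N x = 0)" using exponent assms(2) by auto
    obtain z where z: "\<And>k. k \<in> K \<Longrightarrow> \<bar>p (z - k) - f1 k\<bar> \<le> \<epsilon> / 3"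
      using realise_on_finite_subgroup[OF assms(4) N K(1,2) M, of "\<epsilon> / 3"] \<epsilon> by auto
    have "\<bar>p (z - a) - f a\<bar> \<le> \<epsilon>" if "a \<in> A" for a
    proof -
      have "t a \<in> K" using K(3) that by blast
      then show ?thesis
        using z[of "t a"] t(2)[OF that] f1[OF that] katetov(1)[of a "t a"] katetov(1)[of "t a" a]
          is_valueD(5)[OF val, of a "t a"] is_valueD(6)[OF val, of z a "t a"]
          is_valueD(6)[OF val, of z "t a" a] by linarith
    qed
    then show ?thesis by blast
  qed
  moreover have "1 \<le> r" using assms(1) by auto
  ultimately show ?thesis
    using Urysohn_criterion[OF complete sep, of r] pr by auto
qed

end
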